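(* Let $G$ be a counterexample to Sullivan's conjecture. Suppose that $H$ is an orientation satisfying $|N^-_1(H,v)|\ge|N^+_2(H,v)|$ for all $v\in V(H)$. Then the lexicographic products $G[H]$ and $H[G]$ are counterexamples to Sullivan's conjecture.
   Context: All directed graphs are finite, with non-empty vertex set, and without loops or multiple arcs. An orientation (oriented graph) is a directed graph with no directed cycle of length 2. For a directed graph $G$ and $v\in V(G)$: $N^+_1(G,v)=\{w : (v,w)\in E(G)\}$ is the out-neighbourhood, $N^-_1(G,v)=\{u : (u,v)\in E(G)\}$ is the in-neighbourhood, and $N^+_2(G,v)=\{w\in V(G)\setminus(N^+_1(G,v)\cup\{v\}) : \exists u\in N^+_1(G,v),\ (u,w)\in E(G)\}$ is the second out-neighbourhood. Sullivan's conjecture states that every oriented graph $G$ contains a vertex $v$ with $|N^+_2(G,v)|\ge|N^-_1(G,v)|$. A counterexample is an orientation $G$ with $|N^+_2(G,v)|<|N^-_1(G,v)|$ for all $v\in V(G)$. The lexicographic product $D[G]$ has vertex set $V(D)\times V(G)$, with an arc from $(v,i)$ to $(w,j)$ iff $(v,w)\in E(D)$, or $v=w$ and $(i,j)\in E(G)$. *)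

theory Defs
  imports "Graph_Theory.Pair_Digraph"
begin

locale oriented_graph = pair_digraph G for G :: "'a pair_pre_digraph" +
  assumes verts_nonempty: "pverts G \<noteq> {}"
    and no_two_cycle: "(u, v) \<in> parcs G \<Longrightarrow> (v, u) \<notin> parcs G"

definition out_nbhd :: "'a pair_pre_digraph \<Rightarrow> 'a \<Rightarrow> 'a set" where
  "out_nbhd G v = {w. (v, w) \<in> parcs G}"

definition in_nbhd :: "'a pair_pre_digraph \<Rightarrow> 'a \<Rightarrow> 'a set" where
  "in_nbhd G v = {u. (u, v) \<in> parcs G}"

definition second_out_nbhd :: "'a pair_pre_digraph \<Rightarrow> 'a \<Rightarrow> 'a set" where
  "second_out_nbhd G v =
     {w \<in> pverts G - (out_nbhd G v \<union> {v}). \<exists>u \<in> out_nbhd G v. (u, w) \<in> parcs G}"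

definition sullivan_counterexample :: "'a pair_pre_digraph \<Rightarrow> bool" where
  "sullivan_counterexample G \<longleftrightarrow>
     oriented_graph G \<and>
     (\<forall>v \<in> pverts G. card (second_out_nbhd G v) < card (in_nbhd G v))"

(* lex_product D G is D[G]: every vertex of D is replaced by a copy of G. *)
definition lex_product ::
  "'a pair_pre_digraph \<Rightarrow> 'b pair_pre_digraph \<Rightarrow> ('a \<times> 'b) pair_pre_digraph" where
  "lex_product D G =
     \<lparr> pverts = pverts D \<times> pverts G,
       parcs = {((v, i), (w, j)) | v i w j.
         v \<in> pverts D \<and> i \<in> pverts G \<and> w \<in> pverts D \<and> j \<in> pverts G \<and>
         ((v, w) \<in> parcs D \<or> v = w \<and> (i, j) \<in> parcs G)} \<rparr>"

end

theory Submission
  imports Defs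
begin

text \<open>A vertex \<open>(w, j)\<close> with \<open>w \<noteq> v\<close> lies in a neighbourhood of \<open>(v, i)\<close> in \<open>D[G]\<close> exactly
  when \<open>w\<close> lies in the corresponding neighbourhood of \<open>v\<close> in \<open>D\<close>, whereas inside the copy of \<open>G\<close>
  at \<open>v\<close> only the neighbourhoods in \<open>G\<close> matter, because \<open>D\<close> has no 2-cycle to return along.
  Hence both cardinalities at \<open>(v, i)\<close> are \<open>|G|\<close> times that of \<open>v\<close> plus that of \<open>i\<close>, and since
  \<open>|G| > 0\<close> strictness in either factor carries over to the product.\<close>

lemma parcs_lex_product [simp]:
  "((v, i), (w, j)) \<in> parcs (lex_product D G) \<longleftrightarrow>
     v \<in> pverts D \<and> i \<in> pverts G \<and> w \<in> pverts D \<and> j \<in> pverts G \<and>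
     ((v, w) \<in> parcs D \<or> v = w \<and> (i, j) \<in> parcs G)"
  by (auto simp: lex_product_def)

lemma pverts_lex_product [simp]: "pverts (lex_product D G) = pverts D \<times> pverts G"
  by (simp add: lex_product_def)

lemma (in oriented_graph) finite_nbhds:
  "finite (in_nbhd G v)" "finite (second_out_nbhd G v)"
proof -
  have "in_nbhd G v \<subseteq> pverts G" "second_out_nbhd G v \<subseteq> pverts G"
    using in_arcsD1 by (auto simp: in_nbhd_def second_out_nbhd_def)
  then show "finite (in_nbhd G v)" "finite (second_out_nbhd G v)"
    using pair_finite_verts by (auto intro: finite_subset)
qed

lemma oriented_graph_lex_product:
  assumes "oriented_graph D" "oriented_graph G"
  shows "oriented_graph (lex_product D G)"
proof -
  interpret D: oriented_graph D by fact
  interpret G: oriented_graph G by fact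
  have fin: "finite (pverts (lex_product D G))"
    using D.pair_finite_verts G.pair_finite_verts by simp
  have wf: "fst e \<in> pverts (lex_product D G)" "snd e \<in> pverts (lex_product D G)"
    if "e \<in> parcs (lex_product D G)" for e
    using that by (auto simp: lex_product_def)
  then have "parcs (lex_product D G) \<subseteq> pverts (lex_product D G) \<times> pverts (lex_product D G)"
    by (auto simp: mem_Times_iff)
  then have fin_arcs: "finite (parcs (lex_product D G))"
    using fin by (meson finite_SigmaI finite_subset)
  \<comment> \<open>The pair v = w with an arc (v, w) of \<open>D\<close> is also excluded: a loop
    is its own reverse, so \<open>no_two_cycle\<close> forbids it.\<close>
  have asym: "(y, x) \<notin> parcs (lex_product D G)" if "(x, y) \<in> parcs (lex_product D G)" for x y
    using that D.no_two_cycle G.no_two_cycle by (cases x; cases y) auto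
  show ?thesis
  proof unfold_locales
    show "pverts (lex_product D G) \<noteq> {}"
      using D.verts_nonempty G.verts_nonempty by simp
    show "fst e \<noteq> snd e" if "e \<in> parcs (lex_product D G)" for e
      using that asym by (metis prod.collapse)
  qed (use fin fin_arcs wf asym in auto)
qed

context
  fixes D :: "'a pair_pre_digraph" and G :: "'b pair_pre_digraph" and v i
  assumes D: "oriented_graph D" and G: "oriented_graph G"
    and v: "v \<in> pverts D" and i: "i \<in> pverts G"
begin

interpretation D: oriented_graph D by (rule D)
interpretation G: oriented_graph G by (rule G)

lemma in_nbhd_lex_product:
  "in_nbhd (lex_product D G) (v, i) = in_nbhd D v \<times> pverts G \<union> {v} \<times> in_nbhd G i"
  using v i D.in_arcsD1 G.in_arcsD1 by (auto simp: in_nbhd_def)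

lemma second_out_nbhd_lex_product:
  "second_out_nbhd (lex_product D G) (v, i) =
     second_out_nbhd D v \<times> pverts G \<union> {v} \<times> second_out_nbhd G i"
proof -
  have "(w, j) \<in> second_out_nbhd (lex_product D G) (v, i) \<longleftrightarrow>
      w \<in> second_out_nbhd D v \<and> j \<in> pverts G \<or> w = v \<and> j \<in> second_out_nbhd G i" for w j
  proof (cases "w = v")
    \<comment> \<open>A two-step path leaving the copy at v and coming back would give a 2-cycle of
      \<open>D\<close> through v, so its middle vertex lies in that copy.\<close>
    case True
    then show ?thesis
      using v i D.no_two_cycle G.in_arcsD2
      by (simp add: second_out_nbhd_def out_nbhd_def) blast
  next
    \<comment> \<open>If the middle vertex lay in the copy at v or at w, then (v, w) would be an arc
      of \<open>D\<close> and (w, j) an out-neighbour already. Conversely, a path v, u, w in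
      \<open>D\<close> lifts through (u, i).\<close>
    case False
    then show ?thesis
      using v i D.in_arcsD2
      by (simp add: second_out_nbhd_def out_nbhd_def) blast
  qed
  then show ?thesis
    by auto
qed

lemma card_in_nbhd_lex_product:
  "card (in_nbhd (lex_product D G) (v, i)) =
     card (in_nbhd D v) * card (pverts G) + card (in_nbhd G i)"
proof -
  have "v \<notin> in_nbhd D v"
    using D.no_two_cycle by (auto simp: in_nbhd_def)
  then have "in_nbhd D v \<times> pverts G \<inter> {v} \<times> in_nbhd G i = {}"
    by auto
  then show ?thesis
    unfolding in_nbhd_lex_product
    by (simp add: card_Un_disjoint card_cartesian_product D.finite_nbhds G.finite_nbhds)
qed

lemma card_second_out_nbhd_lex_product:
  "card (second_out_nbhd (lex_product D G) (v, i)) =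
     card (second_out_nbhd D v) * card (pverts G) + card (second_out_nbhd G i)"
proof -
  have "second_out_nbhd D v \<times> pverts G \<inter> {v} \<times> second_out_nbhd G i = {}"
    by (auto simp: second_out_nbhd_def)
  then show ?thesis
    unfolding second_out_nbhd_lex_product
    by (simp add: card_Un_disjoint card_cartesian_product D.finite_nbhds G.finite_nbhds)
qed

end

theorem theorem6p9:
  fixes G :: "'a pair_pre_digraph" and H :: "'b pair_pre_digraph"
  assumes "sullivan_counterexample G"
    and "oriented_graph H"
    and "\<And>v. v \<in> pverts H \<Longrightarrow> card (in_nbhd H v) \<ge> card (second_out_nbhd H v)"
  shows "sullivan_counterexample (lex_product G H) \<and> sullivan_counterexample (lex_product H G)"
proof -
  have G: "oriented_graph G"
    and less: "\<And>v. v \<in> pverts G \<Longrightarrow> card (second_out_nbhd G v) < card (in_nbhd G v)"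
    using assms(1) by (auto simp: sullivan_counterexample_def)
  interpret H: oriented_graph H by fact
  \<comment> \<open>In \<open>lex_product G H\<close> the strict inequality of \<open>G\<close> is
    multiplied by |H|, so it survives only for a positive factor.\<close>
  have "card (pverts H) > 0"
    using H.verts_nonempty H.pair_finite_verts by (simp add: card_gt_0_iff)
  then have "sullivan_counterexample (lex_product G H)"
    unfolding sullivan_counterexample_def
    using oriented_graph_lex_product[OF G assms(2)] less assms(3)
    by (simp add: card_in_nbhd_lex_product[OF G assms(2)]
        card_second_out_nbhd_lex_product[OF G assms(2)] add_less_le_mono)
  \<comment> \<open>Now \<open>G\<close> supplies the added term: the multiplied inequality of
    \<open>H\<close> is weak, and strictness comes from the copy of \<open>G\<close>.\<close>
  moreover have "sullivan_counterexample (lex_product H G)"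
    unfolding sullivan_counterexample_def
    using oriented_graph_lex_product[OF assms(2) G] less assms(3)
    by (simp add: card_in_nbhd_lex_product[OF assms(2) G]
        card_second_out_nbhd_lex_product[OF assms(2) G] add_le_less_mono)
  ultimately show ?thesis
    by blast
qed

end
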